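(* Let $n>l\geqslant 0$ be real numbers and let $m\geqslant 1$ be an integer. Then $$\kappa_{l}^{frac}(n,m)=\binom{m-1}{s-1}\alpha+\binom{m-1}{t-1}\beta,$$ where $$s=\left\lfloor\frac{1+\sqrt{1+4m(m-1)l/n}}{2}\right\rfloor,\qquad t=\left\lceil\frac{1+\sqrt{1+4m(m-1)l/n}}{2}\right\rceil,$$ and $(\alpha,\beta)$ is the solution of the system $$\binom{m}{s}\alpha+\binom{m}{t}\beta=n,\qquad \binom{m-2}{s-2}\alpha+\binom{m-2}{t-2}\beta=l.$$
   Context: Let $X=[0,n]$ be a real interval and $\lambda$ Lebesgue measure. For real $k,l$ and an integer $m$, a fractional $\{l\}$-intersecting $k$-uniform $m$-family of $X$ is a family $\{F_1,\ldots,F_m\}$ of (measurable) subsets of $X$ with $\lambda(F_i)=k$ for all $i\in[m]$ and $\lambda(F_i\cap F_j)=l$ for all distinct $i,j\in[m]$. $\kappa_l^{frac}(n,m)$ is the largest real $k$ such that such a family exists. Binomial coefficients $\binom{a}{b}$ are $0$ when $b<0$ or $b>a$.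
   Formalization: For m = 1 the second equation of the system reads 0 = l and has no solution when l > 0, so it is imposed only for m ≥ 2; when s = t the solution is not unique and the formula is asserted for every solution. *)

theory Defs
  imports "HOL-Analysis.Analysis"
begin

text \<open>The members of a family are indexed by \<open>{1..m}\<close>, so repeated sets are not excluded a priori.\<close>

definition frac_intersecting_family ::
    "real \<Rightarrow> nat \<Rightarrow> real \<Rightarrow> real \<Rightarrow> (nat \<Rightarrow> real set) \<Rightarrow> bool" where
  "frac_intersecting_family n m k l F \<longleftrightarrow>
     (\<forall>i\<in>{1..m}. F i \<in> sets lebesgue \<and> F i \<subseteq> {0..n} \<and> measure lebesgue (F i) = k) \<and>
     (\<forall>i\<in>{1..m}. \<forall>j\<in>{1..m}. i \<noteq> j \<longrightarrow> measure lebesgue (F i \<inter> F j) = l)"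

definition kappa_frac :: "real \<Rightarrow> real \<Rightarrow> nat \<Rightarrow> real" where
  "kappa_frac l n m = (GREATEST k. \<exists>F. frac_intersecting_family n m k l F)"

text \<open>Integer arguments: entries such as \<open>m - 2\<close> and \<open>s - 2\<close> may be negative, and the binomial
  coefficient then vanishes (in particular it is \<open>0\<close> at \<open>(-1, -1)\<close>).\<close>

definition binom :: "int \<Rightarrow> int \<Rightarrow> real" where
  "binom a b = (if b < 0 \<or> b > a then 0 else real (nat a choose nat b))"

text \<open>The second equation counts pairs of members of the family. For \<open>m = 1\<close> there are no pairs and
  \<open>l\<close> is not constrained by the family, whereas the equation would read \<open>0 = l\<close>; it is therefore
  imposed only for \<open>m \<ge> 2\<close>.\<close>

definition layer_system ::
    "real \<Rightarrow> real \<Rightarrow> nat \<Rightarrow> int \<Rightarrow> int \<Rightarrow> real \<Rightarrow> real \<Rightarrow> bool" where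
  "layer_system n l m s t \<alpha> \<beta> \<longleftrightarrow>
     binom (int m) s * \<alpha> + binom (int m) t * \<beta> = n \<and>
     (m \<ge> 2 \<longrightarrow> binom (int m - 2) (s - 2) * \<alpha> + binom (int m - 2) (t - 2) * \<beta> = l)"

end

theory Submission imports Defs begin

text \<open>
  Let \<open>f\<close> count the members of the family containing a point. Then \<open>\<integral> f = m k\<close> and
  \<open>\<integral> f (f - 1) = m (m - 1) l\<close>, and since \<open>f\<close> is integer-valued and \<open>t \<le> s + 1\<close>, integrating
  \<open>(f - s) (f - t) \<ge> 0\<close> bounds \<open>k\<close> from above. Equality needs \<open>f\<close> to take only the values \<open>s\<close>
  and \<open>t\<close>; this is achieved by cutting \<open>[0, n]\<close> into one piece of length \<open>\<alpha>\<close> for each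
  \<open>s\<close>-subset of the index set and one of length \<open>\<beta>\<close> for each \<open>t\<close>-subset. The choice of \<open>s\<close>
  and \<open>t\<close> around the root of \<open>x (x - 1) = m (m - 1) l / n\<close> is what makes these lengths nonnegative.
\<close>

section \<open>Binomial coefficients with integer arguments\<close>

lemma binom_absorption: "of_int a * binom (a - 1) (b - 1) = of_int b * binom a b"
proof (cases "1 \<le> b \<and> b \<le> a")
  case True
  define p q where "p = nat (a - 1)" and "q = nat (b - 1)"
  have a: "a = int (Suc p)" and b: "b = int (Suc q)"
    using True by (auto simp: p_def q_def)
  have "real (Suc q * (Suc p choose Suc q)) = real (Suc p * (p choose q))"
    by (simp only: Suc_times_binomial)
  moreover have "binom (a - 1) (b - 1) = real (p choose q)"
    using True by (simp add: binom_def p_def q_def)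
  moreover have "binom a b = real (Suc p choose Suc q)"
    using True unfolding a b binom_def by (simp only: nat_int) auto
  ultimately show ?thesis
    by (simp only: a b of_int_of_nat_eq of_nat_mult)
next
  case False
  \<comment> \<open>Both sides vanish here: by the convention in \<open>binom\<close> for
    \<open>b < 0\<close> or \<open>b > a\<close>, and at \<open>b = 0\<close> through the factor
    \<open>b\<close> and the lower entry \<open>-1\<close>.\<close>
  then show ?thesis by (auto simp: binom_def)
qed

lemma binom_absorption2:
  "of_int a * (of_int a - 1) * binom (a - 2) (b - 2) = of_int b * (of_int b - 1) * binom a b"
proof -
  have "(of_int a - 1) * binom (a - 2) (b - 2) = (of_int b - 1) * binom (a - 1) (b - 1)"
    using binom_absorption[of "a - 1" "b - 1"] by simp
  then show ?thesis
    using binom_absorption[of a b] by (metis (no_types, opaque_lifting) mult.assoc mult.left_commute)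
qed

lemma binom_pos: "0 \<le> b \<Longrightarrow> b \<le> a \<Longrightarrow> 0 < binom a b"
  by (simp add: binom_def zero_less_binomial)

text \<open>Removing \<open>T\<close> maps these sets bijectively onto subsets of
  \<open>A - T\<close>. For \<open>T\<close> of size 0, 1 and 2 the counts are the coefficients in
  the length equation, in the value of \<open>k\<close> and in the pair equation.\<close>

lemma card_supersets_of_card:
  assumes "finite A" "T \<subseteq> A"
  shows "real (card {S. S \<subseteq> A \<and> T \<subseteq> S \<and> int (card S) = k}) =
    binom (int (card A) - int (card T)) (k - int (card T))"
proof (cases "int (card T) \<le> k")
  case True
  have fT: "finite T" using assms finite_subset by blast
  have eq: "{S. S \<subseteq> A \<and> T \<subseteq> S \<and> int (card S) = k} =
    (\<lambda>U. T \<union> U) ` {U. U \<subseteq> A - T \<and> card U = nat k - card T}" (is "?L = ?f ` ?R")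
  proof (intro equalityI subsetI)
    fix S assume S: "S \<in> ?L"
    then have "card (S - T) = nat k - card T"
      using fT by (auto simp: card_Diff_subset)
    with S show "S \<in> ?f ` ?R"
      by (intro image_eqI[of _ _ "S - T"]) auto
  next
    fix S assume "S \<in> ?f ` ?R"
    then obtain U where U: "S = T \<union> U" "U \<subseteq> A - T" "card U = nat k - card T" by auto
    have "finite U" using U assms finite_subset by blast
    moreover have "T \<inter> U = {}" using U by blast
    ultimately have "card S = card T + card U"
      using fT unfolding U(1) by (intro card_Un_disjoint)
    with U True assms show "S \<in> ?L" by auto
  qed
  have "inj_on ?f ?R" by (rule inj_onI) blast
  then have "card ?L = card ?R" unfolding eq by (rule card_image)
  also have "\<dots> = (card A - card T) choose (nat k - card T)"
    using n_subsets[of "A - T" "nat k - card T"] assms fT by (simp add: card_Diff_subset)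
  finally have c: "card ?L = (card A - card T) choose (nat k - card T)" .
  have le: "card T \<le> card A" using assms by (rule card_mono)
  have "nat (int (card A) - int (card T)) = card A - card T"
    "nat (k - int (card T)) = nat k - card T" using True by auto
  moreover have "card A - card T < nat k - card T" if "int (card A) < k"
    using that le by linarith
  ultimately show ?thesis using c le True by (auto simp: binom_def)
next
  case False
  then have "{S. S \<subseteq> A \<and> T \<subseteq> S \<and> int (card S) = k} = {}"
    using assms by (auto dest: card_mono[rotated] finite_subset)
  from arg_cong[OF this, of card] False show ?thesis by (simp add: binom_def)
qed

section \<open>Sets with prescribed Venn diagram\<close>

lemma disjoint_intervals_of_lengths:
  fixes w :: "'a \<Rightarrow> real"
  assumes "finite I" "\<And>S. S \<in> I \<Longrightarrow> 0 \<le> w S"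
  shows "\<exists>A. (\<forall>S\<in>I. A S \<in> lmeasurable \<and> A S \<subseteq> {0..sum w I} \<and> measure lebesgue (A S) = w S)
    \<and> disjoint_family_on A I"
  using assms
proof (induction I rule: finite_induct)
  case empty
  then show ?case by (simp add: disjoint_family_on_def)
next
  case (insert x I)
  then obtain A where A: "\<And>S. S \<in> I \<Longrightarrow> A S \<in> lmeasurable \<and> A S \<subseteq> {0..sum w I} \<and> measure lebesgue (A S) = w S"
    and disj: "disjoint_family_on A I" by auto
  have w: "0 \<le> w x" "0 \<le> sum w I" using insert by (auto intro: sum_nonneg)
  \<comment> \<open>The new piece goes on the right; leaving out its left endpoint keeps it disjoint
    from the earlier pieces, which lie in the closed interval \<open>{0..sum w I}\<close>.\<close>
  define B where "B = A(x := {sum w I<..sum w I + w x})"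
  have "B S \<in> lmeasurable \<and> B S \<subseteq> {0..sum w (insert x I)} \<and> measure lebesgue (B S) = w S"
    if "S \<in> insert x I" for S
  proof (cases "S = x")
    case True
    have "{sum w I<..sum w I + w x} \<in> lmeasurable"
      by (rule bounded_set_imp_lmeasurable) (auto intro: bounded_Ioc)
    then show ?thesis using True w insert by (auto simp: B_def)
  next
    case False
    then have "S \<in> I" using that by simp
    with A[OF this] w insert(1,2) False show ?thesis
      by (auto simp: B_def intro: order_trans)
  qed
  moreover have "disjoint_family_on B (insert x I)"
  proof (unfold disjoint_family_on_insert[OF insert(2)], intro conjI)
    have "B S = A S" if "S \<in> I" for S using that insert by (auto simp: B_def)
    then show "disjoint_family_on B I" "B x \<inter> \<Union> (B ` I) = {}"
      using disj A by (fastforce simp: B_def disjoint_family_on_def)+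
  qed
  ultimately show ?case by blast
qed

text \<open>Disjoint pieces \<open>A S\<close> serve as Venn cells: a point of \<open>A S\<close>
  lies in \<open>F i\<close> exactly for \<open>i \<in> S\<close>, so an intersection over
  \<open>T\<close> is the union of the cells with \<open>T \<subseteq> S\<close>.\<close>

lemma family_with_venn_weights:
  fixes w :: "'a set \<Rightarrow> real"
  assumes "finite V" "\<And>S. S \<subseteq> V \<Longrightarrow> 0 \<le> w S"
  obtains F where "\<And>i. F i \<in> lmeasurable" "\<And>i. F i \<subseteq> {0..sum w (Pow V)}"
    "\<And>T. T \<noteq> {} \<Longrightarrow> measure lebesgue (\<Inter>i\<in>T. F i) = (\<Sum>S | S \<subseteq> V \<and> T \<subseteq> S. w S)"
proof -
  obtain A where A: "\<And>S. S \<subseteq> V \<Longrightarrow> A S \<in> lmeasurable"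
     "\<And>S. S \<subseteq> V \<Longrightarrow> A S \<subseteq> {0..sum w (Pow V)}"
     "\<And>S. S \<subseteq> V \<Longrightarrow> measure lebesgue (A S) = w S"
    and disj: "disjoint_family_on A (Pow V)"
    using disjoint_intervals_of_lengths[of "Pow V" w] assms
    by (metis PowI PowD finite_Pow_iff)
  define F where "F i = (\<Union>S\<in>{S. S \<subseteq> V \<and> i \<in> S}. A S)" for i
  have fin: "finite {S. S \<subseteq> V \<and> P S}" for P
    using assms(1) by simp
  show thesis
  proof
    show "F i \<in> lmeasurable" for i
      unfolding F_def using fin A by (intro fmeasurable.finite_UN) auto
    show "F i \<subseteq> {0..sum w (Pow V)}" for i
      unfolding F_def using A by blast
    fix T :: "'a set" assume "T \<noteq> {}"
    have "(\<Inter>i\<in>T. F i) = (\<Union>S\<in>{S. S \<subseteq> V \<and> T \<subseteq> S}. A S)"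
    proof (intro equalityI subsetI)
      fix y assume y: "y \<in> (\<Inter>i\<in>T. F i)"
      then obtain S where S: "S \<subseteq> V" "y \<in> A S" using \<open>T \<noteq> {}\<close> by (auto simp: F_def)
      have "T \<subseteq> S"
      proof
        fix i assume "i \<in> T"
        then obtain S' where "S' \<subseteq> V" "i \<in> S'" "y \<in> A S'" using y by (auto simp: F_def)
        moreover from this S disj have "S' = S" unfolding disjoint_family_on_def by blast
        ultimately show "i \<in> S" by simp
      qed
      with S show "y \<in> (\<Union>S\<in>{S. S \<subseteq> V \<and> T \<subseteq> S}. A S)" by blast
    qed (auto simp: F_def)
    moreover have "measure lebesgue (\<Union>S\<in>{S. S \<subseteq> V \<and> T \<subseteq> S}. A S) =
        (\<Sum>S | S \<subseteq> V \<and> T \<subseteq> S. measure lebesgue (A S))"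
    proof (rule measure_finite_Union)
      show "disjoint_family_on A {S. S \<subseteq> V \<and> T \<subseteq> S}"
        using disj by (rule disjoint_family_on_mono[rotated]) auto
    qed (use fin A(1) in \<open>auto simp del: emeasure_completion dest: fmeasurableD2\<close>)
    ultimately show "measure lebesgue (\<Inter>i\<in>T. F i) = (\<Sum>S | S \<subseteq> V \<and> T \<subseteq> S. w S)"
      using A by simp
  qed
qed

section \<open>The upper bound\<close>

lemma integer_between_consecutive:
  fixes c s t :: int
  assumes "s \<le> t" "t \<le> s + 1"
  shows "0 \<le> c * c - (s + t) * c + s * t"
proof -
  \<comment> \<open>No integer lies strictly between \<open>s\<close> and \<open>t\<close>, so the
    factors never have opposite signs.\<close>
  have "0 \<le> (c - s) * (c - t)"
    using assms by (cases "c \<le> s") (auto intro: mult_nonneg_nonneg mult_nonpos_nonpos)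
  then show ?thesis by (simp add: algebra_simps)
qed

text \<open>With \<open>f\<close> the counting function, the diagonal part of \<open>f * f\<close>
  integrates to \<open>m k\<close> and the rest to \<open>m (m - 1) l\<close>. Moving the diagonal
  across the inequality lowers the coefficient \<open>s + t\<close> to
  \<open>s + t - 1\<close>.\<close>

lemma frac_intersecting_family_bound:
  fixes n k l :: real and m :: nat and s t :: int
  assumes F: "frac_intersecting_family n m k l F" and n: "0 \<le> n"
    and st: "s \<le> t" "t \<le> s + 1"
  shows "(of_int s + of_int t - 1) * (real m * k) \<le>
    real m * (real m - 1) * l + of_int s * of_int t * n"
proof -
  let ?I = "{1..m}" and ?c = "of_int s + of_int t :: real" and ?d = "of_int s * of_int t :: real"
  have sub: "F i \<subseteq> {0..n}" and meas: "F i \<in> sets lebesgue"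
    and k: "measure lebesgue (F i) = k" if "i \<in> ?I" for i
    using F that by (auto simp: frac_intersecting_family_def)
  have lm: "F i \<in> lmeasurable" if "i \<in> ?I" for i
    using sub[OF that] meas[OF that] by (rule fmeasurableI2[of "{0..n}", rotated]) auto
  then have lm2: "F i \<inter> F j \<in> lmeasurable" if "i \<in> ?I" "j \<in> ?I" for i j
    using that by auto
  have kl: "measure lebesgue (F i \<inter> F j) = (if j = i then k else l)" if "i \<in> ?I" "j \<in> ?I" for i j
    using F that by (auto simp: frac_intersecting_family_def)
  \<comment> \<open>This is \<open>(f - s) (f - t)\<close> on \<open>[0, n]\<close>, expanded into
    indicators so that its integral involves only prescribed measures. The indicator on the constant
    term makes it vanish outside \<open>[0, n]\<close>.\<close>
  define g :: "real \<Rightarrow> real" where "g x = (\<Sum>i\<in>?I. \<Sum>j\<in>?I. indicat_real (F i \<inter> F j) x)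
    - ?c * (\<Sum>i\<in>?I. indicat_real (F i) x) + ?d * indicat_real {0..n} x" for x
  have ind: "has_bochner_integral lebesgue (indicat_real S) (measure lebesgue S)"
    if "S \<in> lmeasurable" for S
    using that by (intro has_bochner_integral_real_indicator) (auto simp: fmeasurable_def)
  have g: "has_bochner_integral lebesgue g
    ((\<Sum>i\<in>?I. \<Sum>j\<in>?I. measure lebesgue (F i \<inter> F j))
    - ?c * (\<Sum>i\<in>?I. measure lebesgue (F i)) + ?d * measure lebesgue {0..n})"
    unfolding g_def[abs_def]
    by (intro has_bochner_integral_add has_bochner_integral_diff has_bochner_integral_sum
        has_bochner_integral_mult_right ind lm lm2) auto
  have "0 \<le> g x" for x
  proof (cases "x \<in> {0..n}")
    case True
    define c where "c = int (card (?I \<inter> {i. x \<in> F i}))"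
    have c: "(\<Sum>i\<in>?I. indicat_real (F i) x) = of_int c"
      by (simp add: c_def indicator_def)
    have "(\<Sum>i\<in>?I. \<Sum>j\<in>?I. indicat_real (F i \<inter> F j) x) = of_int c * of_int c"
      unfolding c[symmetric] by (simp add: indicator_inter_arith sum_product)
    then have "g x = of_int (c * c - (s + t) * c + s * t)"
      using True c by (simp add: g_def)
    then show ?thesis using integer_between_consecutive[OF st] by (simp only: of_int_0_le_iff)
  next
    case False
    then have "x \<notin> F i" if "i \<in> ?I" for i using sub[OF that] by auto
    with False show ?thesis by (simp add: g_def)
  qed
  then have "0 \<le> (LINT x|lebesgue. g x)" by simp
  also have "\<dots> = (\<Sum>i\<in>?I. \<Sum>j\<in>?I. measure lebesgue (F i \<inter> F j))
    - ?c * (\<Sum>i\<in>?I. measure lebesgue (F i)) + ?d * measure lebesgue {0..n}"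
    using g by (rule has_bochner_integral_integral_eq)
  also have "(\<Sum>i\<in>?I. \<Sum>j\<in>?I. measure lebesgue (F i \<inter> F j)) =
      (\<Sum>i\<in>?I. \<Sum>j\<in>?I. l + (if j = i then k - l else 0))"
    by (intro sum.cong refl) (simp add: kl)
  also have "\<dots> = real m * (real m * l + (k - l))"
    by (simp add: sum.distrib algebra_simps)
  finally show ?thesis using n k by (simp add: algebra_simps)
qed

section \<open>Families attaining the bound\<close>

lemma layered_family_exists:
  fixes \<alpha> \<beta> :: real and s t :: int
  assumes n: "binom (int m) s * \<alpha> + binom (int m) t * \<beta> = n"
    and l: "m \<ge> 2 \<Longrightarrow> binom (int m - 2) (s - 2) * \<alpha> + binom (int m - 2) (t - 2) * \<beta> = l"
    and nonneg: "0 \<le> \<alpha> \<and> 0 \<le> \<beta> \<or> s = t \<and> 0 \<le> \<alpha> + \<beta>"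
  shows "\<exists>F. frac_intersecting_family n m
    (binom (int m - 1) (s - 1) * \<alpha> + binom (int m - 1) (t - 1) * \<beta>) l F"
proof -
  let ?V = "{1..m}"
  \<comment> \<open>Adding the two cases lets the layers coincide when \<open>s = t\<close>: the
    sets of that size then have weight \<open>\<alpha> + \<beta>\<close>, and only this sum has to
    be nonnegative.\<close>
  define w where "w S = (if int (card S) = s then \<alpha> else 0) + (if int (card S) = t then \<beta> else 0)"
    for S :: "nat set"
  have w: "0 \<le> w S" for S using nonneg by (auto simp: w_def)
  have sumw: "(\<Sum>S | S \<subseteq> ?V \<and> T \<subseteq> S. w S) =
      binom (int m - int (card T)) (s - int (card T)) * \<alpha> +
      binom (int m - int (card T)) (t - int (card T)) * \<beta>" if "T \<subseteq> ?V" for T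
  proof -
    have fin: "finite {S. S \<subseteq> ?V \<and> T \<subseteq> S}" by simp
    have "(\<Sum>S | S \<subseteq> ?V \<and> T \<subseteq> S. if int (card S) = u then c else 0) =
        binom (int m - int (card T)) (u - int (card T)) * c" for u and c :: real
      using card_supersets_of_card[OF _ that, of u] fin
      by (simp add: conj_assoc flip: sum.inter_filter)
    then show ?thesis by (simp add: w_def sum.distrib)
  qed
  obtain F where F: "\<And>i. F i \<in> lmeasurable" "\<And>i. F i \<subseteq> {0..sum w (Pow ?V)}"
    "\<And>T. T \<noteq> {} \<Longrightarrow> measure lebesgue (\<Inter>i\<in>T. F i) = (\<Sum>S | S \<subseteq> ?V \<and> T \<subseteq> S. w S)"
    using family_with_venn_weights[of ?V w] w by auto
  \<comment> \<open>The empty set, singletons and pairs as \<open>T\<close> give in turn the total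
    length, the measure of a member and that of a pairwise intersection.\<close>
  have "sum w (Pow ?V) = n"
    using sumw[of "{}"] n by (simp add: Pow_def)
  moreover have "measure lebesgue (F i) =
      binom (int m - 1) (s - 1) * \<alpha> + binom (int m - 1) (t - 1) * \<beta>" if "i \<in> ?V" for i
    using F(3)[of "{i}"] sumw[of "{i}"] that by simp
  moreover have "measure lebesgue (F i \<inter> F j) = l" if "i \<in> ?V" "j \<in> ?V" "i \<noteq> j" for i j
    using F(3)[of "{i, j}"] sumw[of "{i, j}"] that l by simp
  ultimately have "frac_intersecting_family n m
    (binom (int m - 1) (s - 1) * \<alpha> + binom (int m - 1) (t - 1) * \<beta>) l F"
    unfolding frac_intersecting_family_def using F(1,2) by (auto intro: fmeasurableD)
  then show ?thesis by blast
qed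

section \<open>The linear system and its root\<close>

text \<open>Multiplying the pair equation by \<open>m (m - 1)\<close> and absorbing leaves only the
  total layer lengths \<open>binom (int m) s * \<alpha>\<close> and
  \<open>binom (int m) t * \<beta>\<close>. For \<open>m = 1\<close> it becomes
  \<open>0 = 0\<close>, as \<open>s = t = 1\<close>, in agreement with the guard in
  \<open>layer_system\<close>.\<close>

lemma layer_system_iff:
  assumes "m \<ge> 1" and "m = 1 \<Longrightarrow> s = 1 \<and> t = 1"
  shows "layer_system n l m s t \<alpha> \<beta> \<longleftrightarrow>
    binom (int m) s * \<alpha> + binom (int m) t * \<beta> = n \<and>
    of_int s * (of_int s - 1) * (binom (int m) s * \<alpha>) +
    of_int t * (of_int t - 1) * (binom (int m) t * \<beta>) = real m * (real m - 1) * l"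
proof (cases "m = 1")
  case True
  then show ?thesis using assms by (simp add: layer_system_def)
next
  case False
  then have m: "m \<ge> 2" and pos: "real m * (real m - 1) \<noteq> 0" using assms by auto
  have "of_int s * (of_int s - 1) * (binom (int m) s * \<alpha>) +
    of_int t * (of_int t - 1) * (binom (int m) t * \<beta>) =
    (of_int s * (of_int s - 1) * binom (int m) s) * \<alpha> +
    (of_int t * (of_int t - 1) * binom (int m) t) * \<beta>"
    by (simp only: mult.assoc)
  also have "\<dots> = real m * (real m - 1) *
      (binom (int m - 2) (s - 2) * \<alpha> + binom (int m - 2) (t - 2) * \<beta>)"
    unfolding binom_absorption2[symmetric] by (simp add: algebra_simps)
  finally show ?thesis using m pos by (simp add: layer_system_def)
qed

text \<open>The rounded number is the larger root of \<open>x (x - 1) = m (m - 1) y\<close>. It is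
  at least 1 as \<open>y \<ge> 0\<close> and at most \<open>m\<close> as \<open>y < 1\<close>, and
  \<open>x (x - 1)\<close> is monotone for \<open>x \<ge> 1\<close>.\<close>

lemma floor_ceiling_root_bounds:
  fixes y :: real and m :: nat and s t :: int
  assumes y: "0 \<le> y" "y < 1" and m: "m \<ge> 1"
    and s: "s = \<lfloor>(1 + sqrt (1 + 4 * real m * (real m - 1) * y)) / 2\<rfloor>"
    and t: "t = \<lceil>(1 + sqrt (1 + 4 * real m * (real m - 1) * y)) / 2\<rceil>"
  shows "1 \<le> s" "s \<le> t" "t \<le> s + 1" "t \<le> int m"
    "of_int s * (of_int s - 1) \<le> real m * (real m - 1) * y"
    "real m * (real m - 1) * y \<le> of_int t * (of_int t - 1)"
proof -
  define q where "q = real m * (real m - 1) * y"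
  have q0: "0 \<le> q" using y m by (simp add: q_def)
  have qm: "q \<le> real m * (real m - 1)"
    unfolding q_def using y m by (intro mult_left_le) auto
  define x where "x = (1 + sqrt (1 + 4 * q)) / 2"
  have sx: "s = \<lfloor>x\<rfloor>" and tx: "t = \<lceil>x\<rceil>" using s t by (simp_all add: x_def q_def mult.assoc)
  have x1: "1 \<le> x" using q0 by (simp add: x_def)
  have "2 * x - 1 = sqrt (1 + 4 * q)" by (simp add: x_def field_simps)
  then have "(2 * x - 1)\<^sup>2 = 1 + 4 * q" using q0 by simp
  then have xq: "x * (x - 1) = q" by (simp add: power2_eq_square algebra_simps)
  have "sqrt (1 + 4 * q) \<le> 2 * real m - 1"
    using qm m by (intro real_le_lsqrt) (auto simp: power2_eq_square algebra_simps)
  then have xm: "x \<le> real m" by (simp add: x_def)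
  show s1: "1 \<le> s" using x1 by (simp add: sx)
  show "s \<le> t" by (simp add: sx tx floor_le_ceiling)
  show "t \<le> s + 1" using ceiling_diff_floor_le_1[of x] by (simp add: sx tx)
  show "t \<le> int m" using xm by (simp add: tx ceiling_le_iff)
  have "of_int s \<le> x" by (simp add: sx)
  then have "of_int s * (of_int s - 1) \<le> x * (x - 1)"
    using s1 by (intro mult_mono) auto
  then show "of_int s * (of_int s - 1) \<le> real m * (real m - 1) * y" using xq q_def by simp
  have "x \<le> of_int t" by (simp add: tx)
  then have "x * (x - 1) \<le> of_int t * (of_int t - 1)"
    using x1 by (intro mult_mono) auto
  then show "real m * (real m - 1) * y \<le> of_int t * (of_int t - 1)" using xq q_def by simp
qed

text \<open>Cramer's rule in the unknowns \<open>A * \<alpha>\<close> and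
  \<open>B * \<beta>\<close>; the signs of the solution can be read off the numerators.\<close>

lemma two_by_two_system:
  fixes p q A B n r :: real
  assumes "A \<noteq> 0" "B \<noteq> 0" "p \<noteq> q"
  shows "A * \<alpha> + B * \<beta> = n \<and> p * (A * \<alpha>) + q * (B * \<beta>) = r \<longleftrightarrow>
    \<alpha> = (q * n - r) / ((q - p) * A) \<and> \<beta> = (r - p * n) / ((q - p) * B)"
proof -
  have "A * \<alpha> + B * \<beta> = n \<and> p * (A * \<alpha>) + q * (B * \<beta>) = r \<longleftrightarrow>
    (q - p) * (A * \<alpha>) = q * n - r \<and> (q - p) * (B * \<beta>) = r - p * n"
  proof (intro iffI; elim conjE)
    assume h: "(q - p) * (A * \<alpha>) = q * n - r" "(q - p) * (B * \<beta>) = r - p * n"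
    have "(q - p) * (A * \<alpha> + B * \<beta>) = (q - p) * n"
      using h by (simp add: algebra_simps)
    then have sum: "A * \<alpha> + B * \<beta> = n" using assms by simp
    with h show "A * \<alpha> + B * \<beta> = n \<and> p * (A * \<alpha>) + q * (B * \<beta>) = r"
      by (auto simp: algebra_simps)
  qed (auto simp: algebra_simps)
  also have "\<dots> \<longleftrightarrow> \<alpha> = (q * n - r) / ((q - p) * A) \<and> \<beta> = (r - p * n) / ((q - p) * B)"
    using assms by (auto simp: eq_divide_eq mult.commute mult.left_commute)
  finally show ?thesis .
qed

section \<open>Solvability of the system and the extremal value\<close>

theorem theorem2p6:
  fixes n l :: real and m :: nat and s t :: int
  assumes "0 \<le> l" and "l < n" and "m \<ge> 1"
    and "s = \<lfloor>(1 + sqrt (1 + 4 * real m * (real m - 1) * l / n)) / 2\<rfloor>"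
    and "t = \<lceil>(1 + sqrt (1 + 4 * real m * (real m - 1) * l / n)) / 2\<rceil>"
  shows "(\<exists>\<alpha> \<beta>. layer_system n l m s t \<alpha> \<beta>) \<and>
         (s \<noteq> t \<longrightarrow> (\<exists>!p. layer_system n l m s t (fst p) (snd p))) \<and>
         (\<forall>\<alpha> \<beta>. layer_system n l m s t \<alpha> \<beta> \<longrightarrow>
            kappa_frac l n m = binom (int m - 1) (s - 1) * \<alpha> + binom (int m - 1) (t - 1) * \<beta>)"
proof -
  have n: "0 < n" using assms by simp
  have y: "0 \<le> l / n" "l / n < 1" using assms by auto
  note b = floor_ceiling_root_bounds[OF y assms(3), of s t]
  have st: "1 \<le> s" "s \<le> t" "t \<le> s + 1" "t \<le> int m"
    using b assms(4,5) by simp_all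
  define p q :: real where "p = of_int s * (of_int s - 1)" and "q = of_int t * (of_int t - 1)"
  define r where "r = real m * (real m - 1) * l"
  define A B where "A = binom (int m) s" and "B = binom (int m) t"
  \<comment> \<open>The choice of \<open>s\<close> and \<open>t\<close> enters here: both numerators
    of the explicit solution are nonnegative.\<close>
  have pr: "p * n \<le> r" and rq: "r \<le> q * n"
    using b(5,6) assms(4,5) n by (simp_all add: p_def q_def r_def field_simps)
  have A: "0 < A" and B: "0 < B" using st by (auto simp: A_def B_def intro: binom_pos)
  have sys: "layer_system n l m s t \<alpha> \<beta> \<longleftrightarrow> A * \<alpha> + B * \<beta> = n \<and> p * (A * \<alpha>) + q * (B * \<beta>) = r"
    for \<alpha> \<beta>
    unfolding A_def B_def p_def q_def r_def using st assms(3) by (intro layer_system_iff) auto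
  have pq: "p < q" if "s \<noteq> t"
  proof -
    have t: "t = s + 1" using that st by simp
    have "q - p = 2 * of_int s" by (simp add: p_def q_def t algebra_simps)
    with st show ?thesis by simp
  qed
  have sol: "layer_system n l m s t \<alpha> \<beta> \<longleftrightarrow>
      \<alpha> = (q * n - r) / ((q - p) * A) \<and> \<beta> = (r - p * n) / ((q - p) * B)" if "s \<noteq> t" for \<alpha> \<beta>
    unfolding sys using A B pq[OF that] by (intro two_by_two_system) auto
  have ex: "\<exists>\<alpha> \<beta>. layer_system n l m s t \<alpha> \<beta>"
  proof (cases "s = t")
    case True
    \<comment> \<open>Now \<open>p n \<le> r \<le> q n\<close> forces \<open>r = p n\<close>, so the
      second equation is \<open>p\<close> times the first. Only
      \<open>\<alpha> + \<beta> = n / A\<close> is determined, and \<open>\<beta> = 0\<close> is one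
      choice.\<close>
    then have "p = q" by (simp add: p_def q_def)
    then have "layer_system n l m s t (n / A) 0" using A pr rq by (simp add: sys)
    then show ?thesis by blast
  qed (simp add: sol)
  moreover have "\<exists>!p. layer_system n l m s t (fst p) (snd p)" if "s \<noteq> t"
    unfolding sol[OF that] by (metis fst_conv snd_conv prod.collapse)
  moreover have "kappa_frac l n m = binom (int m - 1) (s - 1) * \<alpha> + binom (int m - 1) (t - 1) * \<beta>"
    (is "_ = ?K") if "layer_system n l m s t \<alpha> \<beta>" for \<alpha> \<beta>
    unfolding kappa_frac_def
  proof (rule Greatest_equality)
    note eqs = that[unfolded sys]
    have "0 \<le> \<alpha> \<and> 0 \<le> \<beta> \<or> s = t \<and> 0 \<le> \<alpha> + \<beta>"
    proof (cases "s = t")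
      case True
      then have "A * (\<alpha> + \<beta>) = n" using eqs by (simp add: A_def B_def algebra_simps)
      then show ?thesis using A n True by (metis less_imp_le zero_less_mult_pos)
    next
      case False
      then show ?thesis using that A B pq pr rq by (simp add: sol)
    qed
    then show "\<exists>F. frac_intersecting_family n m ?K l F"
      using that by (intro layered_family_exists) (auto simp: layer_system_def)
    fix k assume "\<exists>F. frac_intersecting_family n m k l F"
    then have "(of_int s + of_int t - 1) * (real m * k) \<le> r + of_int s * of_int t * n"
      using frac_intersecting_family_bound[of n m k l _ s t] n st by (auto simp: r_def)
    \<comment> \<open>With \<open>n\<close> and \<open>r\<close> replaced through the system,
      \<open>A * \<alpha>\<close> has the coefficient
      \<open>s (s - 1) + s t = s (s + t - 1)\<close>, and \<open>B * \<beta>\<close> likewise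
      \<open>t (s + t - 1)\<close>.\<close>
    also have "\<dots> = (of_int s + of_int t - 1) * (of_int s * (A * \<alpha>) + of_int t * (B * \<beta>))"
      unfolding conjunct1[OF eqs, symmetric] conjunct2[OF eqs, symmetric] p_def q_def
      by (simp add: algebra_simps)
    \<comment> \<open>Both sides are the integral of the counting function, taken by layers and by
      members; algebraically this is absorption.\<close>
    also have "of_int s * (A * \<alpha>) + of_int t * (B * \<beta>) = real m * ?K"
      using binom_absorption[of "int m" s] binom_absorption[of "int m" t]
      by (simp add: A_def B_def distrib_left flip: mult.assoc)
    finally show "k \<le> ?K" using st assms(3) by (simp add: mult_le_cancel_left)
  qed
  ultimately show ?thesis by blast
qed

end
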